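(* Let $s\ge 1$ be an integer and let $G$ be a countable group. If $\mathrm{Pol}_s(G)$ is sofic, then $G$ is sofic.
   Context: For groups $G,H$, a map $f:G\to H$ and $g\in G$, define $\partial_g f:G\to H$ by $(\partial_g f)(x)=f(gx)f(x)^{-1}$, and put $\partial_{g_1,\ldots,g_k}f=\partial_{g_1}(\partial_{g_2}(\cdots\partial_{g_k}f))$. Universal polynomial group: let $F_G$ be the free group on the symbols $\{x_g : g\in G\setminus\{1\}\}$, set $x_1=1$, and let $\iota:G\to F_G$, $\iota(g)=x_g$. Let $R_s(G)$ be the normal closure in $F_G$ of all elements $(\partial_{g_1,\ldots,g_{s+1}}\iota)(1)$, $g_1,\ldots,g_{s+1}\in G$. Then $\mathrm{Pol}_s(G)=F_G/R_s(G)$. $\mathrm{Sym}(n)$ carries the normalized Hamming distance $d_n(\sigma,\tau)=1-\frac1n|\mathrm{Fix}(\sigma^{-1}\tau)|$. A countable group $\Gamma$ is sofic if there is a sequence of maps $f_n:\Gamma\to\mathrm{Sym}(m_n)$ ($m_n$ positive integers) with $\lim_n d_{m_n}(f_n(gh),f_n(g)f_n(h))=0$ for all $g,h\in \Gamma$ and $\lim_n d_{m_n}(f_n(g),\mathrm{id})=1$ for every $g\ne1$. *)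

theory Defs
  imports Complex_Main "HOL-Library.Countable_Set" "HOL-Algebra.Algebra"
begin

section \<open>Free groups\<close>

text \<open>
  Elements of the free group on \<open>S\<close> are the reduced words over the letters \<open>(x, True)\<close>,
  standing for the generator \<open>x\<close>, and \<open>(x, False)\<close>, standing for its inverse.
\<close>

type_synonym 'a letter = "'a \<times> bool"

definition flip :: "'a letter \<Rightarrow> 'a letter"
  where "flip l = (fst l, \<not> snd l)"

definition reduced :: "'a letter list \<Rightarrow> bool"
  where "reduced w \<longleftrightarrow> successively (\<lambda>k l. l \<noteq> flip k) w"

fun cons_red :: "'a letter \<Rightarrow> 'a letter list \<Rightarrow> 'a letter list"
  where
    "cons_red l [] = [l]"
  | "cons_red l (k # w) = (if k = flip l then w else l # k # w)"

definition free_group :: "'a set \<Rightarrow> 'a letter list monoid"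
  where "free_group S =
    \<lparr>carrier = {w. set w \<subseteq> S \<times> UNIV \<and> reduced w},
     monoid.mult = (\<lambda>u v. foldr cons_red u v),
     monoid.one = []\<rparr>"

lemma flip_flip [simp]: "flip (flip l) = l"
  by (simp add: flip_def)

lemma flip_neq [simp]: "flip l \<noteq> l" "l \<noteq> flip l"
  by (auto simp: flip_def prod_eq_iff)

lemma reduced_Nil [simp]: "reduced []"
  by (simp add: reduced_def)

lemma reduced_ConsD: "reduced (l # w) \<Longrightarrow> reduced w"
  by (cases w) (auto simp: reduced_def)

lemma reduced_cons_red: "reduced w \<Longrightarrow> reduced (cons_red l w)"
  by (cases w) (auto simp: reduced_def successively_Cons)

lemma cons_red_flip: "reduced w \<Longrightarrow> cons_red l (cons_red (flip l) w) = w"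
  by (cases w; cases "tl w") (auto simp: reduced_def)

lemma cons_red_Cons: "reduced (l # w) \<Longrightarrow> cons_red l w = l # w"
  by (cases w) (auto simp: reduced_def)

lemma reduced_foldr: "reduced v \<Longrightarrow> reduced (foldr cons_red u v)"
  by (induction u) (auto intro: reduced_cons_red)

lemma set_cons_red: "set (cons_red l w) \<subseteq> insert l (set w)"
  by (cases w) auto

lemma set_foldr: "set (foldr cons_red u v) \<subseteq> set u \<union> set v"
  by (induction u) (use set_cons_red in fastforce)+

lemma foldr_cons_red_left:
  assumes "reduced v" "reduced w"
  shows "foldr cons_red (cons_red l v) w = cons_red l (foldr cons_red v w)"
proof (cases "\<exists>v'. v = flip l # v'")
  case True
  then show ?thesis
    using assms by (auto simp: cons_red_flip reduced_foldr)
next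
  case False
  then have "cons_red l v = l # v" by (cases v) auto
  then show ?thesis by simp
qed

lemma foldr_cons_red_assoc:
  assumes "reduced v" "reduced w"
  shows "foldr cons_red (foldr cons_red u v) w = foldr cons_red u (foldr cons_red v w)"
  by (induction u) (use assms in \<open>auto simp: foldr_cons_red_left reduced_foldr\<close>)

lemma foldr_cons_red_inverse: "foldr cons_red (rev (map flip w)) w = []"
  by (induction w) auto

lemma reduced_inverse: "reduced w \<Longrightarrow> reduced (rev (map flip w))"
  unfolding reduced_def successively_rev successively_map
  by (erule successively_mono) (metis flip_flip)

lemma group_free_group: "group (free_group S)"
proof (rule groupI)
  fix u v assume "u \<in> carrier (free_group S)" "v \<in> carrier (free_group S)"
  then show "u \<otimes>\<^bsub>free_group S\<^esub> v \<in> carrier (free_group S)"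
    using set_foldr[of u v] by (auto simp: free_group_def reduced_foldr)
next
  fix u v w
  assume "u \<in> carrier (free_group S)" "v \<in> carrier (free_group S)"
    "w \<in> carrier (free_group S)"
  then show "u \<otimes>\<^bsub>free_group S\<^esub> v \<otimes>\<^bsub>free_group S\<^esub> w =
      u \<otimes>\<^bsub>free_group S\<^esub> (v \<otimes>\<^bsub>free_group S\<^esub> w)"
    by (simp add: free_group_def foldr_cons_red_assoc)
next
  fix w assume w: "w \<in> carrier (free_group S)"
  have "rev (map flip w) \<in> carrier (free_group S)"
    using w by (fastforce simp: free_group_def reduced_inverse flip_def)
  moreover have "rev (map flip w) \<otimes>\<^bsub>free_group S\<^esub> w = \<one>\<^bsub>free_group S\<^esub>"
    by (simp add: free_group_def foldr_cons_red_inverse)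
  ultimately show "\<exists>v \<in> carrier (free_group S). v \<otimes>\<^bsub>free_group S\<^esub> w = \<one>\<^bsub>free_group S\<^esub>"
    by blast
qed (auto simp: free_group_def)


section \<open>Universal polynomial groups\<close>

definition discrete_deriv ::
  "('a, 'm) monoid_scheme \<Rightarrow> ('b, 'n) monoid_scheme \<Rightarrow> 'a \<Rightarrow> ('a \<Rightarrow> 'b) \<Rightarrow> 'a \<Rightarrow> 'b"
  where "discrete_deriv G H g f = (\<lambda>x. f (g \<otimes>\<^bsub>G\<^esub> x) \<otimes>\<^bsub>H\<^esub> inv\<^bsub>H\<^esub> f x)"

text \<open>The derivative along the last entry of the list is taken first.\<close>

definition iterated_deriv ::
  "('a, 'm) monoid_scheme \<Rightarrow> ('b, 'n) monoid_scheme \<Rightarrow> 'a list \<Rightarrow> ('a \<Rightarrow> 'b) \<Rightarrow> 'a \<Rightarrow> 'b"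
  where "iterated_deriv G H gs f = foldr (discrete_deriv G H) gs f"

definition normal_closure :: "('a, 'm) monoid_scheme \<Rightarrow> 'a set \<Rightarrow> 'a set"
  where "normal_closure G R = \<Inter> {N. N \<lhd> G \<and> R \<subseteq> N}"

definition pol_free :: "('a, 'm) monoid_scheme \<Rightarrow> 'a letter list monoid"
  where "pol_free G = free_group (carrier G - {\<one>\<^bsub>G\<^esub>})"

definition pol_iota :: "('a, 'm) monoid_scheme \<Rightarrow> 'a \<Rightarrow> 'a letter list"
  where "pol_iota G g = (if g = \<one>\<^bsub>G\<^esub> then \<one>\<^bsub>pol_free G\<^esub> else [(g, True)])"

definition pol_relations :: "nat \<Rightarrow> ('a, 'm) monoid_scheme \<Rightarrow> 'a letter list set"
  where "pol_relations s G = normal_closure (pol_free G)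
    {iterated_deriv G (pol_free G) gs (pol_iota G) \<one>\<^bsub>G\<^esub> | gs.
      length gs = s + 1 \<and> set gs \<subseteq> carrier G}"

definition Pol :: "nat \<Rightarrow> ('a, 'm) monoid_scheme \<Rightarrow> 'a letter list set monoid"
  where "Pol s G = pol_free G Mod pol_relations s G"

lemma group_pol_free: "group (pol_free G)"
  by (simp add: pol_free_def group_free_group)

lemma pol_iota_closed: "g \<in> carrier G \<Longrightarrow> pol_iota G g \<in> carrier (pol_free G)"
  by (auto simp: pol_iota_def pol_free_def free_group_def reduced_def)

lemma (in group) normal_carrier: "carrier G \<lhd> G"
  by (rule normal_invI) (auto intro: subgroup_self)

lemma (in group) normal_normal_closure:
  assumes "R \<subseteq> carrier G"
  shows "normal_closure G R \<lhd> G"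
proof (rule normal_invI)
  have "carrier G \<in> {N. N \<lhd> G \<and> R \<subseteq> N}"
    using assms normal_carrier by blast
  then show "subgroup (normal_closure G R) G"
    unfolding normal_closure_def
    by (intro subgroups_Inter) (auto simp: normal_imp_subgroup)
next
  fix x h assume "x \<in> carrier G" "h \<in> normal_closure G R"
  then show "x \<otimes> h \<otimes> inv x \<in> normal_closure G R"
    by (auto simp: normal_closure_def normal.inv_op_closed2)
qed

lemma iterated_deriv_closed:
  assumes "group G" "group H" "\<And>x. x \<in> carrier G \<Longrightarrow> f x \<in> carrier H"
    and "set gs \<subseteq> carrier G" "x \<in> carrier G"
  shows "iterated_deriv G H gs f x \<in> carrier H"
  using assms(4,5)
proof (induction gs arbitrary: x)
  case Nil
  then show ?case using assms(3) by (simp add: iterated_deriv_def)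
next
  case (Cons g gs)
  interpret G: group G by fact
  interpret H: group H by fact
  show ?case
    using Cons by (simp add: iterated_deriv_def discrete_deriv_def)
qed

lemma normal_pol_relations:
  assumes "group G"
  shows "pol_relations s G \<lhd> pol_free G"
proof -
  interpret G: group G by fact
  interpret F: group "pol_free G" by (rule group_pol_free)
  show ?thesis
    unfolding pol_relations_def
    by (rule F.normal_normal_closure)
      (auto intro: iterated_deriv_closed[OF assms F.is_group] pol_iota_closed)
qed

lemma group_Pol: "group G \<Longrightarrow> group (Pol s G)"
  unfolding Pol_def by (rule normal.factorgroup_is_group) (rule normal_pol_relations)

lemma countable_Pol:
  assumes "countable (carrier G)"
  shows "countable (carrier (Pol s G))"
proof -
  let ?A = "(carrier G - {\<one>\<^bsub>G\<^esub>}) \<times> (UNIV :: bool set)"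
  have "countable (lists ?A)"
    using assms by (intro countable_lists countable_SIGMA) auto
  then have "countable (carrier (pol_free G))"
    by (rule countable_subset[rotated]) (auto simp: pol_free_def free_group_def)
  moreover have "carrier (Pol s G) =
      (\<lambda>w. pol_relations s G #>\<^bsub>pol_free G\<^esub> w) ` carrier (pol_free G)"
    by (auto simp: Pol_def FactGroup_def RCOSETS_def)
  ultimately show ?thesis by simp
qed


section \<open>Sofic groups\<close>

definition hamming_dist :: "nat \<Rightarrow> (nat \<Rightarrow> nat) \<Rightarrow> (nat \<Rightarrow> nat) \<Rightarrow> real"
  where "hamming_dist n \<sigma> \<tau> =
    1 - real (card {i \<in> {1..n}. (inv\<^bsub>sym_group n\<^esub> \<sigma> \<otimes>\<^bsub>sym_group n\<^esub> \<tau>) i = i}) / real n"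

definition sofic :: "('a, 'm) monoid_scheme \<Rightarrow> bool"
  where "sofic \<Gamma> \<longleftrightarrow> group \<Gamma> \<and> countable (carrier \<Gamma>) \<and>
    (\<exists>(m :: nat \<Rightarrow> nat) (f :: nat \<Rightarrow> 'a \<Rightarrow> nat \<Rightarrow> nat).
      (\<forall>n. m n > 0) \<and>
      (\<forall>n. f n \<in> carrier \<Gamma> \<rightarrow> carrier (sym_group (m n))) \<and>
      (\<forall>g \<in> carrier \<Gamma>. \<forall>h \<in> carrier \<Gamma>.
        (\<lambda>n. hamming_dist (m n) (f n (g \<otimes>\<^bsub>\<Gamma>\<^esub> h)) (f n g \<otimes>\<^bsub>sym_group (m n)\<^esub> f n h))
          \<longlonglongrightarrow> 0) \<and>
      (\<forall>g \<in> carrier \<Gamma>. g \<noteq> \<one>\<^bsub>\<Gamma>\<^esub> \<longrightarrow>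
        (\<lambda>n. hamming_dist (m n) (f n g) \<one>\<^bsub>sym_group (m n)\<^esub>) \<longlonglongrightarrow> 1))"

end

(* The canonical map p : G -> P = Pol_s(G) is polynomial of degree s, sends 1 to 1, and is
   injective because G is the quotient Pol_1(G) of P. If f is polynomial of degree 2, then for
   each g the map x |-> f(gx) f(x)^-1 is a translate of a homomorphism with abelian image, hence
   constant on the derived subgroup; so f restricted to the derived subgroup has degree 1.
   Iterating, p restricts to an injective homomorphism on the (s-1)-st derived subgroup, which is
   therefore sofic. Finally, an extension of a sofic group by an abelian quotient is sofic (the
   Elek-Szabo argument with Folner sets), and this climbs back along the derived series to G. *)

theory Submission
  imports Defs "HOL-Real_Asymp.Real_Asymp"
begin

section \<open>Polynomial maps\<close>

text \<open>Nothing is assumed about the target group, so the commutativity behind the degree-2 step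
  has to be produced. A derivative and its pointwise inverse multiply in opposite orders, and being
  affine for both makes the values blind to the order of the arguments. This blindness kills
  commutators, so each drop of degree costs one step of the derived series. The series need not
  terminate: only s - 1 steps are descended, each with an abelian quotient. The climb back uses a
  finitary form of soficity (a finite set of elements and an error bound, with models on any finite
  set), because the model of an extension lives on a product of a Folner set with a model of the
  kernel.\<close>

text \<open>Degree at most s is expressed by constancy of s-fold derivatives instead of triviality
  of (s+1)-fold ones. Both directions and arguments range over \<open>M\<close>, so passing to a
  subgroup changes only \<open>M\<close> and leaves \<open>f\<close> and \<open>G\<close>
  alone.\<close>

definition polynomial_on ::
  "('a, 'm) monoid_scheme \<Rightarrow> ('b, 'n) monoid_scheme \<Rightarrow> 'a set \<Rightarrow> nat \<Rightarrow> ('a \<Rightarrow> 'b) \<Rightarrow> bool"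
  where "polynomial_on G H M s f \<longleftrightarrow>
    (\<forall>gs. length gs = s \<longrightarrow> set gs \<subseteq> M \<longrightarrow>
      (\<forall>x \<in> M. iterated_deriv G H gs f x = iterated_deriv G H gs f \<one>\<^bsub>G\<^esub>))"

lemma iterated_deriv_snoc:
  "iterated_deriv G H (gs @ [g]) f = iterated_deriv G H gs (discrete_deriv G H g f)"
  by (simp add: iterated_deriv_def)

text \<open>The last direction of the list acts first, so it is the one to peel off; this reduces
  the degree by replacing \<open>f\<close> with its first derivatives.\<close>

lemma polynomial_on_Suc:
  "polynomial_on G H M (Suc s) f \<longleftrightarrow>
    (\<forall>g \<in> M. polynomial_on G H M s (discrete_deriv G H g f))"
proof
  assume L: "polynomial_on G H M (Suc s) f"
  show "\<forall>g \<in> M. polynomial_on G H M s (discrete_deriv G H g f)"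
    unfolding polynomial_on_def
  proof (intro ballI allI impI)
    fix g gs x assume "g \<in> M" "length gs = s" "set gs \<subseteq> M" "x \<in> M"
    then show "iterated_deriv G H gs (discrete_deriv G H g f) x =
        iterated_deriv G H gs (discrete_deriv G H g f) \<one>\<^bsub>G\<^esub>"
      using L unfolding polynomial_on_def iterated_deriv_snoc[symmetric] by simp
  qed
next
  assume R: "\<forall>g \<in> M. polynomial_on G H M s (discrete_deriv G H g f)"
  show "polynomial_on G H M (Suc s) f"
    unfolding polynomial_on_def
  proof (intro ballI allI impI)
    fix gs x assume "length gs = Suc s" "set gs \<subseteq> M" "x \<in> M"
    then show "iterated_deriv G H gs f x = iterated_deriv G H gs f \<one>\<^bsub>G\<^esub>"
      using R by (cases gs rule: rev_cases) (auto simp: iterated_deriv_snoc polynomial_on_def)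
  qed
qed

lemma polynomial_on_0: "polynomial_on G H M 0 f \<longleftrightarrow> (\<forall>x \<in> M. f x = f \<one>\<^bsub>G\<^esub>)"
  by (simp add: polynomial_on_def iterated_deriv_def)

section \<open>Degree drop along the derived series\<close>

text \<open>\<open>f\<close> is a bare map, so the locale is stable under derivatives: its facts can
  be applied to derivatives of \<open>f\<close> by interpretation.\<close>

locale group_map =
  G: group G + H: group H for G :: "('a, 'm) monoid_scheme" and H :: "('b, 'n) monoid_scheme" +
  fixes f :: "'a \<Rightarrow> 'b"
  assumes map_closed: "f \<in> carrier G \<rightarrow> carrier H"
begin

lemma closed [simp]: "x \<in> carrier G \<Longrightarrow> f x \<in> carrier H"
  using map_closed by blast

lemma group_map_deriv: "g \<in> carrier G \<Longrightarrow> group_map G H (discrete_deriv G H g f)"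
  by unfold_locales (auto simp: discrete_deriv_def)

text \<open>In degree 1 the quotient of \<open>f (a x)\<close> by \<open>f x\<close> does not depend
  on x, so it can be read off at x = 1.\<close>

lemma affine:
  assumes "subgroup M G" "polynomial_on G H M 1 f" "a \<in> M" "x \<in> M"
  shows "f (a \<otimes>\<^bsub>G\<^esub> x) = f a \<otimes>\<^bsub>H\<^esub> inv\<^bsub>H\<^esub> f \<one>\<^bsub>G\<^esub> \<otimes>\<^bsub>H\<^esub> f x"
proof -
  have [simp]: "a \<in> carrier G" "x \<in> carrier G"
    using assms subgroup.mem_carrier by metis+
  have "f (a \<otimes>\<^bsub>G\<^esub> x) \<otimes>\<^bsub>H\<^esub> inv\<^bsub>H\<^esub> f x = f a \<otimes>\<^bsub>H\<^esub> inv\<^bsub>H\<^esub> f \<one>\<^bsub>G\<^esub>"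
    using assms(2-4) by (auto simp: polynomial_on_Suc polynomial_on_0 discrete_deriv_def)
  then show ?thesis
    by (metis G.m_closed H.inv_closed H.inv_solve_right H.m_closed \<open>a \<in> carrier G\<close> \<open>x \<in> carrier G\<close>
        G.one_closed closed)
qed

text \<open>
  Both \<open>x \<mapsto> f (g x) f(x)\<inverse>\<close> and its pointwise inverse, which is the derivative of \<open>f\<close> along \<open>g\<inverse>\<close>
  taken at \<open>g x\<close>, are affine. A homomorphism whose pointwise inverse is a homomorphism has
  abelian image, so these maps are constant on the derived subgroup.
\<close>

lemma polynomial_on_derived:
  assumes M: "subgroup M G" and f: "polynomial_on G H M 2 f"
  shows "polynomial_on G H (derived G M) 1 f"
proof -
  have sub: "x \<in> carrier G" if "x \<in> M" for x
    using that M subgroup.mem_carrier by metis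
  have MD: "derived G M \<subseteq> M"
    by (rule G.derived_incl[OF subset_refl M])
  have one: "\<one>\<^bsub>G\<^esub> \<in> M" using M subgroup.one_closed by metis
  have mc: "x \<otimes>\<^bsub>G\<^esub> y \<in> M" if "x \<in> M" "y \<in> M" for x y
    using that M subgroup.m_closed by metis
  have ic: "inv\<^bsub>G\<^esub> x \<in> M" if "x \<in> M" for x
    using that M subgroup.m_inv_closed by metis
  have const: "discrete_deriv G H g f x = discrete_deriv G H g f \<one>\<^bsub>G\<^esub>"
    if g: "g \<in> M" and x: "x \<in> derived G M" for g x
  proof -
    define A where "A = discrete_deriv G H g f"
    define B where "B = discrete_deriv G H (inv\<^bsub>G\<^esub> g) f"
    interpret A: group_map G H A
      unfolding A_def using g sub by (intro group_map_deriv) auto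
    interpret B: group_map G H B
      unfolding B_def using g sub by (intro group_map_deriv) auto
    have polA: "polynomial_on G H M 1 A" and polB: "polynomial_on G H M 1 B"
      using f g ic by (auto simp: A_def B_def numeral_2_eq_2 polynomial_on_Suc)
    note affA = A.affine[OF M polA] and affB = B.affine[OF M polB]
    have AB: "B (g \<otimes>\<^bsub>G\<^esub> y) = inv\<^bsub>H\<^esub> A y" if "y \<in> M" for y
    proof -
      have "inv\<^bsub>G\<^esub> g \<otimes>\<^bsub>G\<^esub> (g \<otimes>\<^bsub>G\<^esub> y) = y"
        using g that sub by (simp flip: G.m_assoc)
      then show ?thesis
        using g that sub by (simp add: A_def B_def discrete_deriv_def H.inv_mult_group)
    qed
    \<comment> \<open>Affineness of \<open>B\<close> at \<open>g y\<close> and at \<open>g\<close>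
      yields \<open>e1\<close> and \<open>e2\<close>; eliminating their common factor leaves a rule
      for \<open>A\<close> with the factors reversed compared with \<open>affA\<close>.\<close>
    have A1: "A (y \<otimes>\<^bsub>G\<^esub> z) = A z \<otimes>\<^bsub>H\<^esub> inv\<^bsub>H\<^esub> A \<one>\<^bsub>G\<^esub> \<otimes>\<^bsub>H\<^esub> A y" if y: "y \<in> M" and z: "z \<in> M" for y z
    proof -
      note [simp] = sub[OF y] sub[OF z] sub[OF g]
      have e1: "inv\<^bsub>H\<^esub> A (y \<otimes>\<^bsub>G\<^esub> z) = inv\<^bsub>H\<^esub> A y \<otimes>\<^bsub>H\<^esub> (inv\<^bsub>H\<^esub> B \<one>\<^bsub>G\<^esub> \<otimes>\<^bsub>H\<^esub> B z)"
        using affB[of "g \<otimes>\<^bsub>G\<^esub> y" z] AB[of "y \<otimes>\<^bsub>G\<^esub> z"] AB[of y] y z g mc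
        by (simp add: G.m_assoc H.m_assoc)
      have e2: "inv\<^bsub>H\<^esub> A z = inv\<^bsub>H\<^esub> A \<one>\<^bsub>G\<^esub> \<otimes>\<^bsub>H\<^esub> (inv\<^bsub>H\<^esub> B \<one>\<^bsub>G\<^esub> \<otimes>\<^bsub>H\<^esub> B z)"
        using affB[of g z] AB[of z] AB[of "\<one>\<^bsub>G\<^esub>"] z g one
        by (simp add: H.m_assoc)
      have e3: "inv\<^bsub>H\<^esub> B \<one>\<^bsub>G\<^esub> \<otimes>\<^bsub>H\<^esub> B z = A \<one>\<^bsub>G\<^esub> \<otimes>\<^bsub>H\<^esub> inv\<^bsub>H\<^esub> A z"
        unfolding e2 by (simp flip: H.m_assoc)
      have "inv\<^bsub>H\<^esub> A (y \<otimes>\<^bsub>G\<^esub> z) = inv\<^bsub>H\<^esub> (A z \<otimes>\<^bsub>H\<^esub> inv\<^bsub>H\<^esub> A \<one>\<^bsub>G\<^esub> \<otimes>\<^bsub>H\<^esub> A y)"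
        unfolding e1 e3 by (simp add: H.inv_mult_group H.m_assoc)
      then have "inv\<^bsub>H\<^esub> (inv\<^bsub>H\<^esub> A (y \<otimes>\<^bsub>G\<^esub> z)) =
          inv\<^bsub>H\<^esub> (inv\<^bsub>H\<^esub> (A z \<otimes>\<^bsub>H\<^esub> inv\<^bsub>H\<^esub> A \<one>\<^bsub>G\<^esub> \<otimes>\<^bsub>H\<^esub> A y))"
        by (rule arg_cong)
      then show ?thesis by simp
    qed
    have comm: "A (y \<otimes>\<^bsub>G\<^esub> z) = A (z \<otimes>\<^bsub>G\<^esub> y)" if "y \<in> M" "z \<in> M" for y z
      using A1[OF that] affA[OF that(2) that(1)] by simp
    let ?K = "{x \<in> M. A x = A \<one>\<^bsub>G\<^esub>}"
    have "subgroup ?K G"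
    proof (rule G.subgroupI)
      show "?K \<subseteq> carrier G" "?K \<noteq> {}" using sub one by auto
    next
      fix a assume a: "a \<in> ?K"
      have "A \<one>\<^bsub>G\<^esub> = A \<one>\<^bsub>G\<^esub> \<otimes>\<^bsub>H\<^esub> inv\<^bsub>H\<^esub> A \<one>\<^bsub>G\<^esub> \<otimes>\<^bsub>H\<^esub> A (inv\<^bsub>G\<^esub> a)"
        using affA[of a "inv\<^bsub>G\<^esub> a"] a sub ic by simp
      then show "inv\<^bsub>G\<^esub> a \<in> ?K"
        using a sub ic by simp
    next
      fix a b assume "a \<in> ?K" "b \<in> ?K"
      then show "a \<otimes>\<^bsub>G\<^esub> b \<in> ?K" using affA[of a b] mc sub by simp
    qed
    moreover have "derived_set G M \<subseteq> ?K"
    proof (clarify, intro CollectI conjI)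
      fix c y z assume y: "y \<in> M" and z: "z \<in> M"
      let ?c = "y \<otimes>\<^bsub>G\<^esub> z \<otimes>\<^bsub>G\<^esub> inv\<^bsub>G\<^esub> y \<otimes>\<^bsub>G\<^esub> inv\<^bsub>G\<^esub> z"
      show c: "?c \<in> M" using y z mc ic by simp
      \<comment> \<open>Since y z = c (z y) and \<open>A\<close> agrees on y z and z y, affineness
        leaves no room for \<open>A c\<close> to differ from the value at 1.\<close>
      have "?c \<otimes>\<^bsub>G\<^esub> (z \<otimes>\<^bsub>G\<^esub> y) = y \<otimes>\<^bsub>G\<^esub> z"
        using sub[OF y] sub[OF z] by (metis G.inv_closed G.inv_solve_right G.m_assoc G.m_closed)
      then have "A (z \<otimes>\<^bsub>G\<^esub> y) = A ?c \<otimes>\<^bsub>H\<^esub> inv\<^bsub>H\<^esub> A \<one>\<^bsub>G\<^esub> \<otimes>\<^bsub>H\<^esub> A (z \<otimes>\<^bsub>G\<^esub> y)"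
        using affA[OF c mc[OF z y]] comm[OF y z] by simp
      then have "A ?c \<otimes>\<^bsub>H\<^esub> inv\<^bsub>H\<^esub> A \<one>\<^bsub>G\<^esub> = \<one>\<^bsub>H\<^esub>"
        using sub[OF c] sub[OF mc[OF z y]]
        by (metis A.closed G.one_closed H.inv_closed H.m_closed H.r_cancel_one)
      then show "A ?c = A \<one>\<^bsub>G\<^esub>"
        using sub[OF c] by (metis A.closed G.one_closed H.inv_closed H.inv_equality H.inv_inv)
    qed
    ultimately have "derived G M \<subseteq> ?K"
      unfolding derived_def by (intro G.generate_subgroup_incl) auto
    with x show ?thesis by (auto simp: A_def)
  qed
  then show ?thesis
    using MD by (auto simp: polynomial_on_Suc polynomial_on_0)
qed

text \<open>The induction generalises \<open>f\<close>: its first derivatives have degree 1 on the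
  n-th derived subgroup by hypothesis, so \<open>f\<close> has degree 2 there, and one more derived
  subgroup brings it to 1.\<close>

lemma polynomial_on_iterated_derived:
  assumes M: "subgroup M G" and f: "polynomial_on G H M (Suc n) f"
  shows "polynomial_on G H ((derived G ^^ n) M) 1 f"
  using group_map_axioms f
proof (induction n arbitrary: f)
  case 0
  then show ?case by simp
next
  case (Suc n)
  interpret f: group_map G H f by fact
  have M': "subgroup ((derived G ^^ n) M) G"
    by (rule G.exp_of_derived_is_subgroup[OF M])
  have "(derived G ^^ n) M \<subseteq> M"
  proof (induction n)
    case (Suc n)
    then show ?case using G.derived_incl[OF Suc M] by simp
  qed simp
  then have "polynomial_on G H ((derived G ^^ n) M) 1 (discrete_deriv G H g f)"
    if "g \<in> (derived G ^^ n) M" for g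
    using that Suc.prems(2) subgroup.mem_carrier[OF M] polynomial_on_Suc
    by (intro Suc.IH f.group_map_deriv) blast+
  then have "polynomial_on G H ((derived G ^^ n) M) 2 f"
    by (simp add: numeral_2_eq_2 polynomial_on_Suc)
  then show ?case
    using f.polynomial_on_derived[OF M'] by simp
qed

end

section \<open>The canonical map into the universal polynomial group\<close>

text \<open>Serves two homomorphisms out of the free group: evaluation in \<open>G\<close> and
  projection to \<open>Pol s G\<close>.\<close>

lemma iterated_deriv_hom:
  assumes "group G" "group_hom H K \<phi>" "f \<in> carrier G \<rightarrow> carrier H"
    and "set gs \<subseteq> carrier G" "x \<in> carrier G"
  shows "iterated_deriv G K gs (\<phi> \<circ> f) x = \<phi> (iterated_deriv G H gs f x)"
  using assms(4,5)
proof (induction gs arbitrary: x)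
  case Nil
  then show ?case by (simp add: iterated_deriv_def)
next
  case (Cons g gs)
  interpret G: group G by fact
  interpret \<phi>: group_hom H K \<phi> by fact
  have "iterated_deriv G H gs f y \<in> carrier H" if "y \<in> carrier G" for y
    using iterated_deriv_closed[OF assms(1) \<phi>.G.is_group _ _ that] assms(3) Cons.prems by auto
  then show ?case
    using Cons by (simp add: iterated_deriv_def discrete_deriv_def)
qed

text \<open>The derivative of the identity along g is the constant g, and constants have trivial
  derivative. Two directions are needed, which is where s >= 1 enters later.\<close>

lemma iterated_deriv_ident:
  assumes "group G" "length gs \<ge> 2" "set gs \<subseteq> carrier G" "x \<in> carrier G"
  shows "iterated_deriv G G gs (\<lambda>x. x) x = \<one>\<^bsub>G\<^esub>"
proof -
  interpret G: group G by fact
  obtain gs' h g where gs: "gs = gs' @ [h, g]"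
    using assms(2) by (metis One_nat_def Suc_1 append.assoc append_Cons append_Nil
        length_0_conv length_append_singleton not_less_eq_eq le0 rev_exhaust list.size(3) not_one_le_zero)
  have g: "g \<in> carrier G" "h \<in> carrier G" "set gs' \<subseteq> carrier G"
    using assms(3) gs by auto
  have "iterated_deriv G G gs' (discrete_deriv G G h (discrete_deriv G G g (\<lambda>x. x))) x = \<one>\<^bsub>G\<^esub>"
    using g(3) assms(4)
  proof (induction gs' arbitrary: x)
    case Nil
    then show ?case
      using g by (simp add: iterated_deriv_def discrete_deriv_def G.m_assoc)
  next
    case (Cons k ks)
    then show ?case by (simp add: iterated_deriv_def discrete_deriv_def)
  qed
  then show ?thesis
    by (simp add: gs iterated_deriv_def)
qed

definition letter_val :: "('a, 'm) monoid_scheme \<Rightarrow> 'a letter \<Rightarrow> 'a"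
  where "letter_val G l = (if snd l then fst l else inv\<^bsub>G\<^esub> fst l)"

text \<open>The homomorphism given by the universal property of the free group for the tautological
  assignment of g to the generator of g.\<close>

definition word_val :: "('a, 'm) monoid_scheme \<Rightarrow> 'a letter list \<Rightarrow> 'a"
  where "word_val G w = foldr (\<lambda>l u. letter_val G l \<otimes>\<^bsub>G\<^esub> u) w \<one>\<^bsub>G\<^esub>"

context group
begin

lemma letter_val_closed: "fst l \<in> carrier G \<Longrightarrow> letter_val G l \<in> carrier G"
  by (simp add: letter_val_def)

lemma word_val_closed: "set w \<subseteq> carrier G \<times> UNIV \<Longrightarrow> word_val G w \<in> carrier G"
  by (induction w) (auto simp: word_val_def letter_val_closed)

lemma word_val_cons_red:
  assumes "fst l \<in> carrier G" "set w \<subseteq> carrier G \<times> UNIV"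
  shows "word_val G (cons_red l w) = letter_val G l \<otimes> word_val G w"
proof (cases w)
  case (Cons k v)
  then have "word_val G v \<in> carrier G" using assms by (auto intro: word_val_closed)
  then have "word_val G v = letter_val G l \<otimes> (letter_val G (flip l) \<otimes> word_val G v)"
    using assms(1) by (auto simp: letter_val_def flip_def simp flip: m_assoc)
  then show ?thesis using Cons by (auto simp: word_val_def)
qed (simp add: word_val_def)

lemma word_val_foldr_cons_red:
  assumes "set u \<subseteq> carrier G \<times> UNIV" "set v \<subseteq> carrier G \<times> UNIV"
  shows "word_val G (foldr cons_red u v) = word_val G u \<otimes> word_val G v"
  using assms(1)
proof (induction u)
  case Nil
  then show ?case using word_val_closed[OF assms(2)] by (simp add: word_val_def)
next
  case (Cons l u)
  have "word_val G (foldr cons_red (l # u) v) = letter_val G l \<otimes> word_val G (foldr cons_red u v)"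
    using Cons.prems assms(2) set_foldr[of u v] by (auto intro!: word_val_cons_red)
  then show ?case
    using Cons word_val_closed[OF assms(2)] word_val_closed[of u] letter_val_closed[of l]
    by (auto simp: word_val_def m_assoc)
qed

lemma word_val_hom: "group_hom (pol_free G) G (word_val G)"
proof (intro group_hom.intro group_hom_axioms.intro homI)
  show "group (pol_free G)" by (rule group_pol_free)
  show "word_val G w \<in> carrier G" if "w \<in> carrier (pol_free G)" for w
    using that by (intro word_val_closed) (auto simp: pol_free_def free_group_def)
  show "word_val G (u \<otimes>\<^bsub>pol_free G\<^esub> v) = word_val G u \<otimes> word_val G v"
    if "u \<in> carrier (pol_free G)" "v \<in> carrier (pol_free G)" for u v
  proof -
    have "set u \<subseteq> carrier G \<times> UNIV" "set v \<subseteq> carrier G \<times> UNIV"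
      using that by (auto simp: pol_free_def free_group_def)
    from word_val_foldr_cons_red[OF this] show ?thesis
      by (simp add: pol_free_def free_group_def)
  qed
qed (rule is_group)

lemma word_val_pol_iota: "g \<in> carrier G \<Longrightarrow> word_val G (pol_iota G g) = g"
  by (auto simp: pol_iota_def word_val_def letter_val_def pol_free_def free_group_def)

text \<open>The kernel of evaluation is normal, so checking the generating relations is enough;
  evaluation turns them into derivatives of the identity map.\<close>

lemma pol_relations_subset_kernel:
  assumes "s \<ge> 1"
  shows "pol_relations s G \<subseteq> kernel (pol_free G) G (word_val G)"
proof -
  interpret \<phi>: group_hom "pol_free G" G "word_val G" by (rule word_val_hom)
  have "iterated_deriv G (pol_free G) gs (pol_iota G) \<one> \<in> kernel (pol_free G) G (word_val G)"
    if gs: "length gs = s + 1" "set gs \<subseteq> carrier G" for gs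
  proof -
    have "word_val G (iterated_deriv G (pol_free G) gs (pol_iota G) \<one>)
        = iterated_deriv G G gs (word_val G \<circ> pol_iota G) \<one>"
      using gs by (intro iterated_deriv_hom[symmetric] is_group word_val_hom)
        (auto intro: pol_iota_closed)
    also have "\<dots> = iterated_deriv G G gs (\<lambda>x. x) \<one>"
    \<comment> \<open>The two maps agree only on the carrier, so the derivatives are compared
      pointwise.\<close>
    proof -
      have "iterated_deriv G G gs (word_val G \<circ> pol_iota G) x = iterated_deriv G G gs (\<lambda>x. x) x"
        if "x \<in> carrier G" for x
        using gs(2) that
        by (induction gs arbitrary: x)
          (auto simp: iterated_deriv_def discrete_deriv_def word_val_pol_iota)
      then show ?thesis by simp
    qed
    also have "\<dots> = \<one>"
      using gs assms by (intro iterated_deriv_ident is_group) auto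
    finally show ?thesis
      using gs(2) iterated_deriv_closed[OF is_group \<phi>.G.is_group pol_iota_closed]
      by (simp add: kernel_def)
  qed
  then show ?thesis
    unfolding pol_relations_def normal_closure_def
    using \<phi>.normal_kernel by (intro Inter_lower) blast
qed

definition pol_map :: "nat \<Rightarrow> 'a \<Rightarrow> 'a letter list set"
  where "pol_map s g = pol_relations s G #>\<^bsub>pol_free G\<^esub> pol_iota G g"

lemma pol_map_closed: "g \<in> carrier G \<Longrightarrow> pol_map s g \<in> carrier (Pol s G)"
  by (auto simp: Pol_def carrier_FactGroup pol_map_def pol_iota_closed)

lemma group_map_pol_map: "group_map G (Pol s G) (pol_map s)"
  by (intro group_map.intro group_map_axioms.intro group_Pol is_group) (auto intro: pol_map_closed)

lemma pol_map_one: "pol_map s \<one> = \<one>\<^bsub>Pol s G\<^esub>"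
proof -
  interpret F: group "pol_free G" by (rule group_pol_free)
  interpret normal "pol_relations s G" "pol_free G" by (rule normal_pol_relations[OF is_group])
  show ?thesis
    by (simp add: pol_map_def pol_iota_def Pol_def subset)
qed

text \<open>A trivial image puts the generator of g among the relations, which evaluation sends to
  1, while it sends the generator to g. As \<open>pol_map\<close> is not a homomorphism on
  \<open>G\<close>, this becomes injectivity only on a subgroup where it is one.\<close>

lemma pol_map_eq_one:
  assumes "s \<ge> 1" "g \<in> carrier G" "pol_map s g = \<one>\<^bsub>Pol s G\<^esub>"
  shows "g = \<one>"
proof -
  interpret F: group "pol_free G" by (rule group_pol_free)
  interpret normal "pol_relations s G" "pol_free G" by (rule normal_pol_relations[OF is_group])
  have "pol_iota G g \<in> pol_relations s G"
    using assms(2,3) F.coset_join1[OF _ pol_iota_closed subgroup_axioms, of g] subset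
    by (auto simp: pol_map_def Pol_def)
  then have "word_val G (pol_iota G g) = \<one>"
    using pol_relations_subset_kernel[OF assms(1)] by (auto simp: kernel_def)
  then show ?thesis
    by (simp add: word_val_pol_iota[OF assms(2)])
qed

lemma polynomial_on_pol_map: "polynomial_on G (Pol s G) (carrier G) s (pol_map s)"
  unfolding polynomial_on_def
proof (intro allI impI ballI)
  fix gs x assume gs: "length gs = s" "set gs \<subseteq> carrier G" and x: "x \<in> carrier G"
  interpret F: group "pol_free G" by (rule group_pol_free)
  interpret N: normal "pol_relations s G" "pol_free G" by (rule normal_pol_relations[OF is_group])
  interpret P: group "Pol s G" by (rule group_Pol[OF is_group])
  interpret \<pi>: group_hom "pol_free G" "Pol s G" "\<lambda>w. pol_relations s G #>\<^bsub>pol_free G\<^esub> w"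
    by unfold_locales (use N.r_coset_hom_Mod in \<open>simp add: Pol_def\<close>)
  let ?d = "\<lambda>gs. iterated_deriv G (pol_free G) gs (pol_iota G)"
  let ?D = "\<lambda>gs. iterated_deriv G (Pol s G) gs (pol_map s)"
  have hom: "?D hs y = pol_relations s G #>\<^bsub>pol_free G\<^esub> ?d hs y"
    if "set hs \<subseteq> carrier G" "y \<in> carrier G" for hs y
    using iterated_deriv_hom[OF is_group \<pi>.group_hom_axioms _ that, of "pol_iota G"]
    by (simp add: pol_map_def[abs_def] comp_def pol_iota_closed)
  \<comment> \<open>The relations constrain derivatives at 1 only. Taking the point x as an extra
    outermost direction compares the s-fold derivative at x with that at 1.\<close>
  have "?d (x # gs) \<one> \<in> pol_relations s G"
    unfolding pol_relations_def normal_closure_def using gs x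
    by (intro InterI) (force intro: exI[of _ "x # gs"])
  then have "?D (x # gs) \<one> = \<one>\<^bsub>Pol s G\<^esub>"
    using hom[of "x # gs" \<one>] gs x N.rcos_const by (simp add: Pol_def)
  moreover have "?D gs y \<in> carrier (Pol s G)" if "y \<in> carrier G" for y
    using gs that by (intro iterated_deriv_closed is_group P.is_group pol_map_closed)
  ultimately show "?D gs x = ?D gs \<one>"
    using x by (simp add: iterated_deriv_def discrete_deriv_def)
      (metis P.inv_closed P.inv_equality P.inv_inv one_closed)
qed

text \<open>Degree \<open>Suc n\<close> becomes 1 after n derived subgroups, and an affine map
  sending 1 to 1 is multiplicative.\<close>

lemma pol_map_hom:
  fixes n :: nat
  defines "N \<equiv> (derived G ^^ n) (carrier G)"
  shows "pol_map (Suc n) \<in> hom (G\<lparr>carrier := N\<rparr>) (Pol (Suc n) G)"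
proof (rule homI)
  interpret group_map G "Pol (Suc n) G" "pol_map (Suc n)" by (rule group_map_pol_map)
  have N: "subgroup N G"
    unfolding N_def by (rule exp_of_derived_is_subgroup[OF subgroup_self])
  fix x y assume xy: "x \<in> carrier (G\<lparr>carrier := N\<rparr>)" "y \<in> carrier (G\<lparr>carrier := N\<rparr>)"
  then have [simp]: "x \<in> carrier G" "y \<in> carrier G" using subgroup.mem_carrier[OF N] by auto
  show "pol_map (Suc n) x \<in> carrier (Pol (Suc n) G)" by simp
  have "polynomial_on G (Pol (Suc n) G) N 1 (pol_map (Suc n))"
    unfolding N_def
    by (rule polynomial_on_iterated_derived[OF subgroup_self polynomial_on_pol_map])
  from affine[OF N this, of x y] xy
  show "pol_map (Suc n) (x \<otimes>\<^bsub>G\<lparr>carrier := N\<rparr>\<^esub> y) =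
      pol_map (Suc n) x \<otimes>\<^bsub>Pol (Suc n) G\<^esub> pol_map (Suc n) y"
    by (simp add: pol_map_one)
qed

end


section \<open>Local soficity\<close>

text \<open>The model may live on any finite set, and both conditions count bad points instead of
  using a distance. Every element of the group acts bijectively, but only those of \<open>F\<close>
  are controlled.\<close>

definition sofic_approx ::
  "('a, 'm) monoid_scheme \<Rightarrow> 'a set \<Rightarrow> real \<Rightarrow> 'b set \<Rightarrow> ('a \<Rightarrow> 'b \<Rightarrow> 'b) \<Rightarrow> bool"
  where "sofic_approx G F \<epsilon> Y \<sigma> \<longleftrightarrow> finite Y \<and> Y \<noteq> {} \<and>
    (\<forall>g \<in> carrier G. bij_betw (\<sigma> g) Y Y) \<and>
    (\<forall>g \<in> F. \<forall>h \<in> F.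
      real (card {y \<in> Y. \<sigma> (g \<otimes>\<^bsub>G\<^esub> h) y \<noteq> \<sigma> g (\<sigma> h y)}) \<le> \<epsilon> * real (card Y)) \<and>
    (\<forall>g \<in> F. g \<noteq> \<one>\<^bsub>G\<^esub> \<longrightarrow> real (card {y \<in> Y. \<sigma> g y = y}) \<le> \<epsilon> * real (card Y))"

text \<open>The type \<open>nat set\<close> is fixed because a definition cannot quantify over
  types; \<open>locally_soficI\<close> admits models of any type.\<close>

definition locally_sofic :: "('a, 'm) monoid_scheme \<Rightarrow> bool"
  where "locally_sofic G \<longleftrightarrow>
    (\<forall>F \<epsilon>. finite F \<longrightarrow> F \<subseteq> carrier G \<longrightarrow> \<epsilon> > 0 \<longrightarrow>
      (\<exists>(Y :: nat set) \<sigma>. sofic_approx G F \<epsilon> Y \<sigma>))"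

text \<open>Conjugation by \<open>b\<close> preserves the sets of bad points up to
  relabelling.\<close>

lemma sofic_approx_transport:
  assumes "monoid G" "F \<subseteq> carrier G" "sofic_approx G F \<epsilon> Y \<sigma>" "bij_betw b Y Z"
  shows "sofic_approx G F \<epsilon> Z (\<lambda>g z. b (\<sigma> g (inv_into Y b z)))"
proof -
  interpret monoid G by fact
  let ?\<tau> = "\<lambda>g z. b (\<sigma> g (inv_into Y b z))"
  have inj: "inj_on b Y" and Z: "Z = b ` Y"
    using assms(4) by (auto simp: bij_betw_def)
  have bij: "bij_betw (\<sigma> g) Y Y" if "g \<in> carrier G" for g
    using assms(3) that by (auto simp: sofic_approx_def)
  have mem: "\<sigma> g y \<in> Y" if "g \<in> carrier G" "y \<in> Y" for g y
    using bij[OF that(1)] that(2) bij_betwE by blast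
  have [simp]: "inv_into Y b (b y) = y" if "y \<in> Y" for y
    using inj that by simp
  have [simp]: "card Z = card Y"
    using assms(4) bij_betw_same_card by metis
  have card_eq: "card {z \<in> Z. P z} = card {y \<in> Y. P (b y)}" for P
  proof -
    have "{z \<in> Z. P z} = b ` {y \<in> Y. P (b y)}" by (auto simp: Z)
    then show ?thesis
      using card_image[OF inj_on_subset[OF inj, of "{y \<in> Y. P (b y)}"]] by auto
  qed
  have "bij_betw (?\<tau> g) Z Z" if "g \<in> carrier G" for g
    using bij_betw_trans[OF bij_betw_trans[OF bij_betw_inv_into[OF assms(4)] bij[OF that]] assms(4)]
    by (simp add: comp_def)
  moreover have "{y \<in> Y. ?\<tau> (g \<otimes>\<^bsub>G\<^esub> h) (b y) \<noteq> ?\<tau> g (?\<tau> h (b y))} =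
      {y \<in> Y. \<sigma> (g \<otimes>\<^bsub>G\<^esub> h) y \<noteq> \<sigma> g (\<sigma> h y)}" if "g \<in> F" "h \<in> F" for g h
    using that assms(2) inj mem by (auto simp: inj_on_eq_iff subset_iff)
  moreover have "{y \<in> Y. ?\<tau> g (b y) = b y} = {y \<in> Y. \<sigma> g y = y}" if "g \<in> F" for g
    using that assms(2) inj mem by (auto simp: inj_on_eq_iff subset_iff)
  moreover have "finite Z" "Z \<noteq> {}"
    using assms(3) by (auto simp: Z sofic_approx_def)
  ultimately show ?thesis
    using assms(3) unfolding sofic_approx_def card_eq by simp
qed

lemma locally_soficI:
  assumes "monoid G"
    and "\<And>F \<epsilon>. finite F \<Longrightarrow> F \<subseteq> carrier G \<Longrightarrow> \<epsilon> > 0 \<Longrightarrow>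
      \<exists>(Y :: 'b set) \<sigma>. sofic_approx G F \<epsilon> Y \<sigma>"
  shows "locally_sofic G"
  unfolding locally_sofic_def
proof (intro allI impI)
  fix F and \<epsilon> :: real assume *: "finite F" "F \<subseteq> carrier G" "\<epsilon> > 0"
  then obtain Y :: "'b set" and \<sigma> where Y: "sofic_approx G F \<epsilon> Y \<sigma>"
    using assms(2) by blast
  then have "finite Y" by (simp add: sofic_approx_def)
  then obtain b where "bij_betw b Y {0..<card Y}"
    using ex_bij_betw_finite_nat by blast
  from sofic_approx_transport[OF assms(1) *(2) Y this]
  show "\<exists>(Y :: nat set) \<sigma>. sofic_approx G F \<epsilon> Y \<sigma>" by blast
qed

lemma locally_sofic_embedding:
  assumes "group G" "group H" "f \<in> hom G H" "inj_on f (carrier G)" "locally_sofic H"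
  shows "locally_sofic G"
  unfolding locally_sofic_def
proof (intro allI impI)
  fix F and \<epsilon> :: real assume *: "finite F" "F \<subseteq> carrier G" "\<epsilon> > 0"
  interpret group_hom G H f
    using assms by (simp add: group_hom_def group_hom_axioms_def)
  have "finite (f ` F)" "f ` F \<subseteq> carrier H" using * by auto
  then obtain Y :: "nat set" and \<sigma> where Y: "sofic_approx H (f ` F) \<epsilon> Y \<sigma>"
    using assms(5) *(3) unfolding locally_sofic_def by blast
  have "f g \<noteq> \<one>\<^bsub>H\<^esub>" if "g \<in> carrier G" "g \<noteq> \<one>\<^bsub>G\<^esub>" for g
    using assms(4) that inj_on_one_iff by blast
  then have "sofic_approx G F \<epsilon> Y (\<lambda>g. \<sigma> (f g))"
    using Y *(2) by (auto simp: sofic_approx_def subset_iff)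
  then show "\<exists>(Y :: nat set) \<sigma>. sofic_approx G F \<epsilon> Y \<sigma>" by blast
qed

text \<open>A fixed point of the inverse of \<open>\<sigma>\<close> composed with
  \<open>\<tau>\<close> is a point where the two permutations agree.\<close>

lemma hamming_dist_eq:
  assumes "n > 0" "\<sigma> \<in> carrier (sym_group n)" "\<tau> \<in> carrier (sym_group n)"
  shows "hamming_dist n \<sigma> \<tau> = real (card {i \<in> {1..n}. \<sigma> i \<noteq> \<tau> i}) / real n"
proof -
  have \<sigma>: "bij \<sigma>"
    using assms(2) by (simp add: sym_group_carrier permutes_bij)
  have "{i \<in> {1..n}. (inv\<^bsub>sym_group n\<^esub> \<sigma> \<otimes>\<^bsub>sym_group n\<^esub> \<tau>) i = i} =
      {1..n} - {i \<in> {1..n}. \<sigma> i \<noteq> \<tau> i}"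
    using assms(2) bij_inv_eq_iff[OF \<sigma>] by (auto simp: sym_group_mult) metis+
  moreover have "card {i \<in> {1..n}. \<sigma> i \<noteq> \<tau> i} \<le> card {1..n}"
    by (rule card_mono) auto
  moreover have "card ({1..n} - {i \<in> {1..n}. \<sigma> i \<noteq> \<tau> i}) =
      card {1..n} - card {i \<in> {1..n}. \<sigma> i \<noteq> \<tau> i}"
    by (rule card_Diff_subset) auto
  ultimately show ?thesis
    using assms(1) by (simp add: hamming_dist_def of_nat_diff field_simps)
qed

lemma hamming_dist_one:
  assumes "n > 0" "\<sigma> \<in> carrier (sym_group n)"
  shows "hamming_dist n \<sigma> \<one>\<^bsub>sym_group n\<^esub> = 1 - real (card {i \<in> {1..n}. \<sigma> i = i}) / real n"
proof -
  interpret group "sym_group n" by (rule sym_group_is_group)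
  let ?A = "{i \<in> {1..n}. \<sigma> i = i}" and ?B = "{i \<in> {1..n}. \<sigma> i \<noteq> i}"
  have "card ?A + card ?B = card (?A \<union> ?B)"
    by (rule card_Un_disjoint[symmetric]) auto
  also have "?A \<union> ?B = {1..n}" by auto
  finally have *: "real (card ?B) = real n - real (card ?A)" by simp
  have "hamming_dist n \<sigma> \<one>\<^bsub>sym_group n\<^esub> = real (card ?B) / real n"
    using hamming_dist_eq[OF assms one_closed] by (simp add: sym_group_one)
  then show ?thesis
    unfolding * using assms(1) by (simp add: diff_divide_distrib)
qed

lemma sofic_imp_locally_sofic:
  assumes "sofic G"
  shows "locally_sofic G"
  unfolding locally_sofic_def
proof (intro allI impI)
  fix F and \<epsilon> :: real assume F: "finite F" "F \<subseteq> carrier G" and \<epsilon>: "\<epsilon> > 0"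
  obtain m f where G: "group G" and m: "\<And>n. m n > 0"
    and f: "\<And>n. f n \<in> carrier G \<rightarrow> carrier (sym_group (m n))"
    and lim: "\<And>g h. g \<in> carrier G \<Longrightarrow> h \<in> carrier G \<Longrightarrow>
        (\<lambda>n. hamming_dist (m n) (f n (g \<otimes>\<^bsub>G\<^esub> h)) (f n g \<otimes>\<^bsub>sym_group (m n)\<^esub> f n h)) \<longlonglongrightarrow> 0"
    and lim1: "\<And>g. g \<in> carrier G \<Longrightarrow> g \<noteq> \<one>\<^bsub>G\<^esub> \<Longrightarrow>
        (\<lambda>n. hamming_dist (m n) (f n g) \<one>\<^bsub>sym_group (m n)\<^esub>) \<longlonglongrightarrow> 1"
    using assms unfolding sofic_def by blast
  interpret group G by fact
  \<comment> \<open>As \<open>F\<close> is finite, the finitely many limits share an index from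
    which all bounds hold.\<close>
  have "\<forall>\<^sub>F n in sequentially. \<forall>g \<in> F. \<forall>h \<in> F.
      hamming_dist (m n) (f n (g \<otimes>\<^bsub>G\<^esub> h)) (f n g \<otimes>\<^bsub>sym_group (m n)\<^esub> f n h) < \<epsilon>"
    using F \<epsilon> lim by (intro eventually_ball_finite ballI order_tendstoD) auto
  moreover have "\<forall>\<^sub>F n in sequentially. \<forall>g \<in> F - {\<one>\<^bsub>G\<^esub>}.
      1 - \<epsilon> < hamming_dist (m n) (f n g) \<one>\<^bsub>sym_group (m n)\<^esub>"
    using F \<epsilon> lim1 by (intro eventually_ball_finite ballI order_tendstoD) auto
  ultimately obtain n where n1: "\<forall>g \<in> F. \<forall>h \<in> F.
      hamming_dist (m n) (f n (g \<otimes>\<^bsub>G\<^esub> h)) (f n g \<otimes>\<^bsub>sym_group (m n)\<^esub> f n h) < \<epsilon>"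
    and n2: "\<forall>g \<in> F - {\<one>\<^bsub>G\<^esub>}. 1 - \<epsilon> < hamming_dist (m n) (f n g) \<one>\<^bsub>sym_group (m n)\<^esub>"
    using eventually_happens[OF eventually_conj] by (metis (mono_tags, lifting) sequentially_bot)
  interpret S: group "sym_group (m n)" by (rule sym_group_is_group)
  have fc: "f n g \<in> carrier (sym_group (m n))" if "g \<in> carrier G" for g
    using f that by blast
  have "sofic_approx G F \<epsilon> {1..m n} (f n)"
    unfolding sofic_approx_def
  proof (intro conjI ballI impI)
    show "finite {1..m n}" "{1..m n} \<noteq> {}" using m[of n] by auto
    show "bij_betw (f n g) {1..m n} {1..m n}" if "g \<in> carrier G" for g
      using fc[OF that] by (simp add: sym_group_carrier permutes_imp_bij)
  next
    fix g h assume gh: "g \<in> F" "h \<in> F"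
    then have "g \<in> carrier G" "h \<in> carrier G" using F by auto
    moreover from this have "f n g \<circ> f n h \<in> carrier (sym_group (m n))"
      using S.m_closed[OF fc fc, of g h] by (simp add: sym_group_mult)
    ultimately show "real (card {y \<in> {1..m n}. f n (g \<otimes>\<^bsub>G\<^esub> h) y \<noteq> f n g (f n h y)})
        \<le> \<epsilon> * real (card {1..m n})"
      using n1[rule_format, OF gh] m[of n]
      by (subst (asm) hamming_dist_eq) (auto simp: fc sym_group_mult field_simps)
  next
    fix g assume g: "g \<in> F" "g \<noteq> \<one>\<^bsub>G\<^esub>"
    have gG: "g \<in> carrier G" using g F by auto
    have "1 - \<epsilon> < hamming_dist (m n) (f n g) \<one>\<^bsub>sym_group (m n)\<^esub>" using n2 g by blast
    then have "1 - \<epsilon> < 1 - real (card {y \<in> {1..m n}. f n g y = y}) / real (m n)"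
      by (simp only: hamming_dist_one[OF m fc[OF gG]])
    then show "real (card {y \<in> {1..m n}. f n g y = y}) \<le> \<epsilon> * real (card {1..m n})"
      using m[of n] by (simp add: field_simps)
  qed
  then show "\<exists>(Y :: nat set) \<sigma>. sofic_approx G F \<epsilon> Y \<sigma>" by blast
qed

lemma locally_sofic_permutes:
  assumes "monoid G" "locally_sofic G" "finite F" "F \<subseteq> carrier G" "\<epsilon> > 0"
  shows "\<exists>m f. m > 0 \<and> f \<in> carrier G \<rightarrow> carrier (sym_group m) \<and> sofic_approx G F \<epsilon> {1..m} f"
proof -
  obtain Y :: "nat set" and \<sigma> where Y: "sofic_approx G F \<epsilon> Y \<sigma>"
    using assms(2-5) unfolding locally_sofic_def by blast
  define m where "m = card Y"
  have "finite Y" "m > 0" using Y by (auto simp: sofic_approx_def m_def card_gt_0_iff)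
  then obtain b where b: "bij_betw b Y {1..m}"
    using finite_same_card_bij[of Y "{1..m}"] m_def by fastforce
  define \<tau> where "\<tau> = (\<lambda>g z. b (\<sigma> g (inv_into Y b z)))"
  have \<tau>: "sofic_approx G F \<epsilon> {1..m} \<tau>"
    unfolding \<tau>_def by (rule sofic_approx_transport[OF assms(1,4) Y b])
  \<comment> \<open>Elements of \<open>sym_group m\<close> are permutations of all naturals, so the
    model is extended by the identity outside \<open>{1..m}\<close>.\<close>
  define f where "f = (\<lambda>g z. if z \<in> {1..m} then \<tau> g z else z)"
  have bij: "bij_betw (\<tau> g) {1..m} {1..m}" if "g \<in> carrier G" for g
    using \<tau> that by (auto simp: sofic_approx_def)
  have mem: "\<tau> g z \<in> {1..m}" if "g \<in> carrier G" "z \<in> {1..m}" for g z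
    using bij[OF that(1)] that(2) bij_betwE by blast
  have eq: "f g z = \<tau> g z" if "z \<in> {1..m}" for g z
    using that by (simp add: f_def)
  have "f g permutes {1..m}" if "g \<in> carrier G" for g
  proof (rule bij_imp_permutes)
    show "bij_betw (f g) {1..m} {1..m}"
      using bij[OF that] by (subst bij_betw_cong) (rule eq)
  qed (auto simp: f_def)
  moreover have "sofic_approx G F \<epsilon> {1..m} f"
  proof -
    have "bij_betw (f g) {1..m} {1..m} \<longleftrightarrow> bij_betw (\<tau> g) {1..m} {1..m}" for g
      by (rule bij_betw_cong) (rule eq)
    moreover have "{y \<in> {1..m}. f (g \<otimes>\<^bsub>G\<^esub> h) y \<noteq> f g (f h y)} =
        {y \<in> {1..m}. \<tau> (g \<otimes>\<^bsub>G\<^esub> h) y \<noteq> \<tau> g (\<tau> h y)}" if "h \<in> F" for g h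
    proof -
      have h: "h \<in> carrier G" using that assms(4) by blast
      have "f (g \<otimes>\<^bsub>G\<^esub> h) y \<noteq> f g (f h y) \<longleftrightarrow> \<tau> (g \<otimes>\<^bsub>G\<^esub> h) y \<noteq> \<tau> g (\<tau> h y)"
        if "y \<in> {1..m}" for y
        unfolding eq[OF that] eq[OF mem[OF h that]] ..
      then show ?thesis by blast
    qed
    moreover have "{y \<in> {1..m}. f g y = y} = {y \<in> {1..m}. \<tau> g y = y}" for g
      using eq by metis
    ultimately show ?thesis using \<tau> unfolding sofic_approx_def by simp
  qed
  ultimately show ?thesis
    using \<open>m > 0\<close> by (intro exI[of _ m] exI[of _ f] conjI) (simp_all add: sym_group_carrier)
qed

lemma locally_sofic_imp_sofic:
  assumes "group G" "countable (carrier G)" "locally_sofic G"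
  shows "sofic G"
proof -
  interpret group G by fact
  \<comment> \<open>A diagonal sequence: the n-th model handles \<open>e 0\<close>, ...,
    \<open>e n\<close> with error 1/(n+1). The enumeration may repeat elements, so finite groups are
    covered.\<close>
  define e where "e = from_nat_into (carrier G)"
  have "carrier G \<noteq> {}" by auto
  then have e: "range e = carrier G"
    unfolding e_def using assms(2) by (rule range_from_nat_into)
  have "\<exists>m f. m > 0 \<and> f \<in> carrier G \<rightarrow> carrier (sym_group m) \<and>
      sofic_approx G (e ` {..n}) (1 / real (Suc n)) {1..m} f" for n
    using e by (intro locally_sofic_permutes monoid_axioms assms(3)) auto
  then obtain m f where m: "\<And>n. m n > 0"
    and f: "\<And>n. f n \<in> carrier G \<rightarrow> carrier (sym_group (m n))"
    and ap: "\<And>n. sofic_approx G (e ` {..n}) (1 / real (Suc n)) {1..m n} (f n)"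
    by metis
  have fc: "f n g \<in> carrier (sym_group (m n))" if "g \<in> carrier G" for n g
    using f that by blast
  have ev: "\<forall>\<^sub>F n in sequentially. g \<in> e ` {..n}" if "g \<in> carrier G" for g
  proof -
    obtain k where "g = e k" using e \<open>g \<in> carrier G\<close> by blast
    then show ?thesis by (auto simp: eventually_sequentially intro!: exI[of _ k])
  qed
  have "(\<lambda>n. hamming_dist (m n) (f n (g \<otimes>\<^bsub>G\<^esub> h)) (f n g \<otimes>\<^bsub>sym_group (m n)\<^esub> f n h)) \<longlonglongrightarrow> 0"
    if gh: "g \<in> carrier G" "h \<in> carrier G" for g h
  proof (rule tendsto_sandwich[OF _ _ tendsto_const LIMSEQ_inverse_real_of_nat])
    have eq: "hamming_dist (m n) (f n (g \<otimes>\<^bsub>G\<^esub> h)) (f n g \<otimes>\<^bsub>sym_group (m n)\<^esub> f n h) =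
        real (card {y \<in> {1..m n}. f n (g \<otimes>\<^bsub>G\<^esub> h) y \<noteq> f n g (f n h y)}) / real (m n)" for n
    proof -
      interpret S: group "sym_group (m n)" by (rule sym_group_is_group)
      have "f n g \<circ> f n h \<in> carrier (sym_group (m n))"
        using S.m_closed[OF fc fc, of g h] gh by (simp add: sym_group_mult)
      then show ?thesis
        using gh m[of n] by (subst hamming_dist_eq) (auto simp: fc sym_group_mult)
    qed
    show "\<forall>\<^sub>F n in sequentially.
        0 \<le> hamming_dist (m n) (f n (g \<otimes>\<^bsub>G\<^esub> h)) (f n g \<otimes>\<^bsub>sym_group (m n)\<^esub> f n h)"
      by (simp add: eq)
    show "\<forall>\<^sub>F n in sequentially.
        hamming_dist (m n) (f n (g \<otimes>\<^bsub>G\<^esub> h)) (f n g \<otimes>\<^bsub>sym_group (m n)\<^esub> f n h)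
          \<le> inverse (real (Suc n))"
      using ev[OF gh(1)] ev[OF gh(2)]
    proof eventually_elim
      case (elim n)
      then have "real (card {y \<in> {1..m n}. f n (g \<otimes>\<^bsub>G\<^esub> h) y \<noteq> f n g (f n h y)})
          \<le> 1 / real (Suc n) * real (m n)"
        using ap[of n] unfolding sofic_approx_def by auto
      then show ?case
        using m[of n] by (simp add: eq pos_divide_le_eq inverse_eq_divide)
    qed
  qed
  moreover have "(\<lambda>n. hamming_dist (m n) (f n g) \<one>\<^bsub>sym_group (m n)\<^esub>) \<longlonglongrightarrow> 1"
    if g: "g \<in> carrier G" "g \<noteq> \<one>\<^bsub>G\<^esub>" for g
  proof -
    have "(\<lambda>n. real (card {y \<in> {1..m n}. f n g y = y}) / real (m n)) \<longlonglongrightarrow> 0"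
    proof (rule tendsto_sandwich[OF _ _ tendsto_const LIMSEQ_inverse_real_of_nat])
      show "\<forall>\<^sub>F n in sequentially. real (card {y \<in> {1..m n}. f n g y = y}) / real (m n)
          \<le> inverse (real (Suc n))"
        using ev[OF g(1)]
      proof eventually_elim
        case (elim n)
        then have "real (card {y \<in> {1..m n}. f n g y = y}) \<le> 1 / real (Suc n) * real (m n)"
          using ap[of n] g unfolding sofic_approx_def by auto
        then show ?case
          using m[of n] by (simp add: pos_divide_le_eq inverse_eq_divide)
      qed
    qed simp
    from tendsto_diff[OF tendsto_const[of 1] this] show ?thesis
      using g by (simp add: hamming_dist_one m fc)
  qed
  ultimately show ?thesis
    unfolding sofic_def using assms(1,2) m f by blast
qed


section \<open>Extensions with abelian quotient\<close>

text \<open>Products of powers of the listed elements with exponents from 0 to n. Negative exponents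
  are absent because only translation by the listed elements themselves is to be controlled.\<close>

fun box :: "('a, 'm) monoid_scheme \<Rightarrow> 'a list \<Rightarrow> nat \<Rightarrow> 'a set"
  where
    "box G [] n = {\<one>\<^bsub>G\<^esub>}"
  | "box G (g # gs) n = (\<lambda>(i, b). g [^]\<^bsub>G\<^esub> i \<otimes>\<^bsub>G\<^esub> b) ` ({..n :: nat} \<times> box G gs n)"

lemma finite_box: "finite (box G gs n)"
  by (induction gs) auto

lemma card_box: "card (box G gs n) \<le> (n + 1) ^ length gs"
proof (induction gs)
  case (Cons g gs)
  have "card (box G (g # gs) n) \<le> card ({..n} \<times> box G gs n)"
    unfolding box.simps by (intro card_image_le finite_cartesian_product finite_box) auto
  also have "\<dots> \<le> (n + 1) * (n + 1) ^ length gs"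
    using Cons mult_le_mono2 by (simp add: card_cartesian_product del: mult_Suc)
  finally show ?case by simp
qed simp

lemma box_mono: "m \<le> n \<Longrightarrow> box G gs m \<subseteq> box G gs n"
  by (induction gs) (auto 4 4)

context comm_group
begin

lemma box_closed: "set gs \<subseteq> carrier G \<Longrightarrow> box G gs n \<subseteq> carrier G"
  by (induction gs) auto

lemma one_in_box: "set gs \<subseteq> carrier G \<Longrightarrow> \<one> \<in> box G gs n"
proof (induction gs)
  case (Cons g gs)
  then show ?case by (force intro!: image_eqI[of _ _ "(0, \<one>)"])
qed simp

text \<open>Commutativity lets g travel to its own power, whose exponent grows by one.\<close>

lemma mult_box:
  assumes "set gs \<subseteq> carrier G" "g \<in> set gs" "t \<in> box G gs n"
  shows "g \<otimes> t \<in> box G gs (Suc n)"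
  using assms
proof (induction gs arbitrary: t)
  case (Cons h gs)
  obtain i b where i: "i \<le> n" and b: "b \<in> box G gs n" and t: "t = h [^] i \<otimes> b"
    using Cons.prems(3) by auto
  have [simp]: "h \<in> carrier G" "b \<in> carrier G" "g \<in> carrier G"
    using Cons.prems(1,2) box_closed[of gs n] b by auto
  show ?case
  proof (cases "g = h")
    case True
    have "g \<otimes> t = h [^] Suc i \<otimes> b"
      using True by (simp add: t m_ac)
    then show ?thesis
      using i b box_mono[of n "Suc n" G gs] by (force intro!: image_eqI[of _ _ "(Suc i, b)"])
  next
    case False
    then have "g \<otimes> b \<in> box G gs (Suc n)" using Cons b by simp
    moreover have "g \<otimes> t = h [^] i \<otimes> (g \<otimes> b)"
      by (simp add: t m_lcomm)
    ultimately show ?thesis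
      using i by (force intro!: image_eqI[of _ _ "(i, g \<otimes> b)"])
  qed
qed simp

text \<open>The boxes grow polynomially, so they cannot grow by a factor \<open>1 + \<epsilon>\<close> at every step.\<close>

lemma Folner_set:
  assumes "finite F" "F \<subseteq> carrier G" "\<epsilon> > (0 :: real)"
  obtains T where "finite T" "T \<noteq> {}" "T \<subseteq> carrier G"
    "\<And>g. g \<in> F \<Longrightarrow> real (card {t \<in> T. g \<otimes> t \<notin> T}) \<le> \<epsilon> * real (card T)"
proof -
  obtain gs where gs: "set gs = F" using assms(1) finite_list by blast
  have gsG: "set gs \<subseteq> carrier G" using gs assms(2) by simp
  let ?B = "box G gs"
  have pos: "card (?B n) > 0" for n
    using one_in_box[OF gsG, of n] finite_box[of G gs n] by (auto simp: card_gt_0_iff)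
  have "\<exists>n. real (card (?B (Suc n))) \<le> (1 + \<epsilon>) * real (card (?B n))"
  proof (rule ccontr)
    assume "\<not> ?thesis"
    then have grow: "(1 + \<epsilon>) * real (card (?B n)) < real (card (?B (Suc n)))" for n
      by (simp add: not_le)
    have "(1 + \<epsilon>) ^ n \<le> real (card (?B n))" for n
    proof (induction n)
      case 0
      then show ?case using pos[of 0] by simp
    next
      case (Suc n)
      have "(1 + \<epsilon>) * (1 + \<epsilon>) ^ n \<le> (1 + \<epsilon>) * real (card (?B n))"
        using Suc assms(3) by (intro mult_left_mono) auto
      then show ?case using grow[of n] by simp
    qed
    moreover have "real (card (?B n)) \<le> real (n + 1) ^ length gs" for n
      using card_box[of G gs n] by (metis of_nat_le_iff of_nat_power)
    ultimately have le: "(1 + \<epsilon>) ^ n \<le> real (n + 1) ^ length gs" for n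
      using order_trans by blast
    have "((\<lambda>n. real (n + 1) ^ length gs / (1 + \<epsilon>) ^ n) \<longlongrightarrow> 0) sequentially"
      using assms(3) by real_asymp
    then have "\<forall>\<^sub>F n in sequentially. real (n + 1) ^ length gs / (1 + \<epsilon>) ^ n < 1"
      by (rule order_tendstoD) simp
    then obtain n where "real (n + 1) ^ length gs / (1 + \<epsilon>) ^ n < 1"
      using eventually_happens by force
    then show False using le[of n] assms(3) by (simp add: divide_less_eq)
  qed
  then obtain n where n: "real (card (?B (Suc n))) \<le> (1 + \<epsilon>) * real (card (?B n))" by blast
  show ?thesis
  proof (rule that[of "?B n"])
    show "finite (?B n)" by (rule finite_box)
    show "?B n \<noteq> {}" using pos[of n] by auto
    show "?B n \<subseteq> carrier G" by (rule box_closed[OF gsG])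
    fix g assume g: "g \<in> F"
    then have gG: "g \<in> carrier G" using assms(2) by blast
    \<comment> \<open>Points leaving the box are translated injectively into the shell between
      consecutive boxes, which is small by the choice of n.\<close>
    let ?S = "{t \<in> ?B n. g \<otimes> t \<notin> ?B n}"
    have "inj_on (\<lambda>t. g \<otimes> t) ?S"
      using box_closed[OF gsG, of n] gG by (auto simp: inj_on_def subset_iff)
    then have "card ?S = card ((\<lambda>t. g \<otimes> t) ` ?S)" by (simp add: card_image)
    also have "\<dots> \<le> card (?B (Suc n) - ?B n)"
      using g gs mult_box[OF gsG] by (intro card_mono) (auto simp: finite_box)
    also have "\<dots> = card (?B (Suc n)) - card (?B n)"
      by (intro card_Diff_subset finite_box box_mono) simp
    finally have "real (card ?S) \<le> real (card (?B (Suc n))) - real (card (?B n))"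
      using card_mono[OF finite_box box_mono, of n "Suc n" G gs] by simp
    then show "real (card ?S) \<le> \<epsilon> * real (card (?B n))"
      using n by (simp add: algebra_simps)
  qed
qed

end

section \<open>Models for extensions\<close>

text \<open>The complements of \<open>D\<close> and its image have equal size, so any bijection
  between them completes \<open>f\<close>. The values off \<open>D\<close> are arbitrary and will be
  charged to the error.\<close>

lemma inj_on_extend_bij_betw:
  assumes "finite Y" "D \<subseteq> Y" "inj_on f D" "f ` D \<subseteq> Y"
  obtains f' where "bij_betw f' Y Y" "\<And>y. y \<in> D \<Longrightarrow> f' y = f y"
proof -
  have "finite D" using assms finite_subset by blast
  have "card (Y - D) = card (Y - f ` D)"
    using assms \<open>finite D\<close> by (simp add: card_Diff_subset card_image)
  then obtain h where h: "bij_betw h (Y - D) (Y - f ` D)"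
    using finite_same_card_bij[of "Y - D" "Y - f ` D"] assms(1) by auto
  let ?f = "\<lambda>y. if y \<in> D then f y else h y"
  have "bij_betw ?f D (f ` D)"
    using inj_on_imp_bij_betw[OF assms(3)] by (subst bij_betw_cong[where g = f]) auto
  moreover have "bij_betw ?f (Y - D) (Y - f ` D)"
    using h by (subst bij_betw_cong[where g = h]) auto
  ultimately have "bij_betw ?f (D \<union> (Y - D)) (f ` D \<union> (Y - f ` D))"
    by (rule bij_betw_combine) auto
  moreover have "D \<union> (Y - D) = Y" "f ` D \<union> (Y - f ` D) = Y" using assms by auto
  ultimately show ?thesis by (intro that[of ?f]) auto
qed

text \<open>
  \<open>G\<close> acts on \<open>Q \<times> N\<close>, for \<open>Q\<close> the quotient and \<open>N\<close> the kernel, through the cocycle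
  \<open>c g q = (r (\<pi> g q))\<inverse> g (r q)\<close> given by a section \<open>r\<close>. A finite model is obtained by restricting
  \<open>Q\<close> to a Folner set \<open>T\<close> and replacing \<open>N\<close> by a sofic approximation \<open>Y\<close>.
\<close>

lemma locally_sofic_extension:
  assumes hom: "group_hom G Q \<pi>" and Q: "comm_group Q"
    and surj: "\<pi> ` carrier G = carrier Q"
    and ker: "locally_sofic (G\<lparr>carrier := kernel G Q \<pi>\<rparr>)"
  shows "locally_sofic G"
proof (rule locally_soficI)
  interpret group_hom G Q \<pi> by fact
  interpret Q: comm_group Q by fact
  show "monoid G" by (rule G.is_monoid)
  fix F and \<epsilon>' :: real assume F: "finite F" "F \<subseteq> carrier G" and \<epsilon>': "\<epsilon>' > 0"
  \<comment> \<open>Multiplicativity can fail in three ways, each costing one share: the base point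
    leaves \<open>T\<close> under h, it leaves under g afterwards, or \<open>\<sigma>\<close> errs
    in the fibre.\<close>
  define \<epsilon> where "\<epsilon> = \<epsilon>' / 3"
  have \<epsilon>: "\<epsilon> > 0" using \<epsilon>' by (simp add: \<epsilon>_def)
  define r where "r = inv_into (carrier G) \<pi>"
  have rG [simp]: "r q \<in> carrier G" and \<pi>r [simp]: "\<pi> (r q) = q" if "q \<in> carrier Q" for q
    using that surj by (auto simp: r_def inv_into_into f_inv_into_f)
  define c where "c g q = inv\<^bsub>G\<^esub> r (\<pi> g \<otimes>\<^bsub>Q\<^esub> q) \<otimes>\<^bsub>G\<^esub> g \<otimes>\<^bsub>G\<^esub> r q" for g q
  have c_kernel: "c g q \<in> kernel G Q \<pi>" if "g \<in> carrier G" "q \<in> carrier Q" for g q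
    using that by (simp add: c_def kernel_def H.m_assoc)
  have cocycle: "c (g \<otimes>\<^bsub>G\<^esub> h) q = c g (\<pi> h \<otimes>\<^bsub>Q\<^esub> q) \<otimes>\<^bsub>G\<^esub> c h q"
    if "g \<in> carrier G" "h \<in> carrier G" "q \<in> carrier Q" for g h q
  proof -
    let ?p = "r (\<pi> h \<otimes>\<^bsub>Q\<^esub> q)"
    have "?p \<otimes>\<^bsub>G\<^esub> (inv\<^bsub>G\<^esub> ?p \<otimes>\<^bsub>G\<^esub> (h \<otimes>\<^bsub>G\<^esub> r q)) = h \<otimes>\<^bsub>G\<^esub> r q"
      using that by (simp flip: G.m_assoc)
    then show ?thesis
      using that by (simp add: c_def H.m_assoc G.m_assoc)
  qed
  \<comment> \<open>When the base point is fixed, \<open>c g q\<close> is a conjugate of g.\<close>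
  have c_one: "c g q \<noteq> \<one>\<^bsub>G\<^esub>"
    if "g \<in> carrier G" "q \<in> carrier Q" "\<pi> g \<otimes>\<^bsub>Q\<^esub> q = q" "g \<noteq> \<one>\<^bsub>G\<^esub>" for g q
  proof
    assume "c g q = \<one>\<^bsub>G\<^esub>"
    then have "g \<otimes>\<^bsub>G\<^esub> r q = r q"
      using that by (simp add: c_def G.m_assoc G.inv_solve_left')
    then show False using that by (metis G.r_cancel_one rG)
  qed
  obtain T where T: "finite T" "T \<noteq> {}" "T \<subseteq> carrier Q"
    and Folner: "\<And>g. g \<in> \<pi> ` F \<Longrightarrow> real (card {t \<in> T. g \<otimes>\<^bsub>Q\<^esub> t \<notin> T}) \<le> \<epsilon> * real (card T)"
  proof (rule Q.Folner_set)
    show "finite (\<pi> ` F)" "\<pi> ` F \<subseteq> carrier Q" "\<epsilon> > 0" using F \<epsilon> by auto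
  qed blast
  \<comment> \<open>The kernel elements that can occur over \<open>T\<close>; the model of the
    kernel has to be good on these.\<close>
  define S where "S = (\<lambda>(g, t). c g t) ` (F \<times> T)"
  have "finite S" "S \<subseteq> carrier (G\<lparr>carrier := kernel G Q \<pi>\<rparr>)"
    using F T c_kernel by (auto simp: S_def)
  then obtain Y :: "nat set" and \<sigma> where Y: "sofic_approx (G\<lparr>carrier := kernel G Q \<pi>\<rparr>) S \<epsilon> Y \<sigma>"
    using ker \<epsilon> unfolding locally_sofic_def by blast
  have S: "c g t \<in> S" if "g \<in> F" "t \<in> T" for g t
    using that by (auto simp: S_def)
  have finY: "finite Y" "Y \<noteq> {}" using Y by (auto simp: sofic_approx_def)
  have \<sigma>_bij: "bij_betw (\<sigma> n) Y Y" if "n \<in> kernel G Q \<pi>" for n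
    using Y that by (auto simp: sofic_approx_def)
  have \<sigma>_mem: "\<sigma> n y \<in> Y" if "n \<in> kernel G Q \<pi>" "y \<in> Y" for n y
    using \<sigma>_bij[OF that(1)] that(2) bij_betwE by blast
  define W where "W = T \<times> Y"
  have W: "finite W" "W \<noteq> {}" "card W = card T * card Y"
    using T finY by (auto simp: W_def card_cartesian_product)
  \<comment> \<open>The part of \<open>W\<close> on which the genuine action stays inside
    \<open>W\<close>; elsewhere \<open>\<rho>\<close> is an arbitrary completion to a
    bijection.\<close>
  define D where "D g = {t \<in> T. \<pi> g \<otimes>\<^bsub>Q\<^esub> t \<in> T} \<times> Y" for g
  define act where "act g = (\<lambda>(t, y). (\<pi> g \<otimes>\<^bsub>Q\<^esub> t, \<sigma> (c g t) y))" for g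
  have "\<exists>f'. bij_betw f' W W \<and> (\<forall>x \<in> D g. f' x = act g x)" if g: "g \<in> carrier G" for g
  proof -
    have "inj_on (act g) (D g)"
    proof (rule inj_onI, clarsimp simp: D_def act_def)
      fix t y t' y'
      assume *: "t \<in> T" "y \<in> Y" "t' \<in> T" "y' \<in> Y" "\<pi> g \<otimes>\<^bsub>Q\<^esub> t = \<pi> g \<otimes>\<^bsub>Q\<^esub> t'"
        "\<sigma> (c g t) y = \<sigma> (c g t') y'"
      have t: "t \<in> carrier Q" "t' \<in> carrier Q" using * T by auto
      then have "t = t'" using *(5) g by simp
      moreover have "y = y'"
        using * inj_onD[OF bij_betw_imp_inj_on[OF \<sigma>_bij[OF c_kernel[OF g t(1)]]], of y y'] \<open>t = t'\<close>
        by simp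
      ultimately show "t = t' \<and> y = y'" by simp
    qed
    moreover have "act g ` D g \<subseteq> W" "D g \<subseteq> W"
      using T \<sigma>_mem[OF c_kernel[OF g]] by (auto simp: D_def act_def W_def)
    ultimately show ?thesis
      using inj_on_extend_bij_betw[OF W(1)] by metis
  qed
  then obtain \<rho> where \<rho>_bij: "\<And>g. g \<in> carrier G \<Longrightarrow> bij_betw (\<rho> g) W W"
    and \<rho>: "\<And>g x. g \<in> carrier G \<Longrightarrow> x \<in> D g \<Longrightarrow> \<rho> g x = act g x"
    by metis
  define U where "U g = {t \<in> T. \<pi> g \<otimes>\<^bsub>Q\<^esub> t \<notin> T}" for g
  have finU: "finite (U g)" for g using T by (simp add: U_def)
  have U: "real (card (U g \<times> Y)) \<le> \<epsilon> * real (card W)" if "g \<in> F" for g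
    using mult_right_mono[OF Folner, of "\<pi> g" "real (card Y)"] that
    by (simp add: U_def W(3) card_cartesian_product mult.assoc)
  have fibres: "real (card (SIGMA t:T. Z t)) \<le> \<epsilon> * real (card W)"
    if "\<And>t. t \<in> T \<Longrightarrow> Z t \<subseteq> Y" "\<And>t. t \<in> T \<Longrightarrow> real (card (Z t)) \<le> \<epsilon> * real (card Y)"
    for Z :: "'c \<Rightarrow> nat set"
  proof -
    have "\<forall>t \<in> T. finite (Z t)" using that(1) finY finite_subset by blast
    then have "real (card (SIGMA t:T. Z t)) = (\<Sum>t \<in> T. real (card (Z t)))"
      using T by simp
    also have "\<dots> \<le> (\<Sum>t \<in> T. \<epsilon> * real (card Y))"
      using that(2) by (intro sum_mono) auto
    finally show ?thesis using W(3) by (simp add: mult_ac)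
  qed
  have "sofic_approx G F \<epsilon>' W \<rho>"
    unfolding sofic_approx_def
  proof (intro conjI ballI impI)
    show "finite W" "W \<noteq> {}" by fact+
    show "bij_betw (\<rho> g) W W" if "g \<in> carrier G" for g by (rule \<rho>_bij[OF that])
  next
    fix g h assume gh: "g \<in> F" "h \<in> F"
    then have [simp]: "g \<in> carrier G" "h \<in> carrier G" using F by auto
    \<comment> \<open>Base points lost at the second move. Translation by the image of h embeds
      \<open>V\<close> in \<open>U g\<close>, so it is no larger.\<close>
    define V where "V = {t \<in> T. \<pi> h \<otimes>\<^bsub>Q\<^esub> t \<in> U g}"
    \<comment> \<open>The guard ensures that both cocycle values lie in \<open>S\<close>, where the
      estimates for \<open>\<sigma>\<close> apply.\<close>
    define Z where "Z t = (if \<pi> h \<otimes>\<^bsub>Q\<^esub> t \<in> T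
      then {y \<in> Y. \<sigma> (c g (\<pi> h \<otimes>\<^bsub>Q\<^esub> t) \<otimes>\<^bsub>G\<^esub> c h t) y \<noteq> \<sigma> (c g (\<pi> h \<otimes>\<^bsub>Q\<^esub> t)) (\<sigma> (c h t) y)}
      else {})" for t
    have finV: "finite V" using T by (simp add: V_def)
    have "inj_on (\<lambda>t. \<pi> h \<otimes>\<^bsub>Q\<^esub> t) V"
      using T by (auto simp: inj_on_def V_def subset_iff)
    then have "card V \<le> card (U g)"
      by (rule card_inj_on_le) (auto simp: V_def finU)
    then have "card (V \<times> Y) \<le> card (U g \<times> Y)"
      by (simp add: card_cartesian_product)
    then have V: "real (card (V \<times> Y)) \<le> \<epsilon> * real (card W)"
      using U[OF gh(1)] by linarith
    have "{x \<in> W. \<rho> (g \<otimes>\<^bsub>G\<^esub> h) x \<noteq> \<rho> g (\<rho> h x)} \<subseteq>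
        (U h \<times> Y \<union> V \<times> Y) \<union> (SIGMA t:T. Z t)"
    proof (clarsimp simp: W_def)
      fix t y
      assume t: "t \<in> T" and y: "y \<in> Y"
        and ne: "\<rho> (g \<otimes>\<^bsub>G\<^esub> h) (t, y) \<noteq> \<rho> g (\<rho> h (t, y))"
        and not_Z: "y \<notin> Z t" and not_V: "t \<notin> V"
      have tQ [simp]: "t \<in> carrier Q" using t T by auto
      show "t \<in> U h"
      proof (rule ccontr)
        assume "t \<notin> U h"
        then have ht: "\<pi> h \<otimes>\<^bsub>Q\<^esub> t \<in> T" using t by (simp add: U_def)
        then have ght: "\<pi> g \<otimes>\<^bsub>Q\<^esub> (\<pi> h \<otimes>\<^bsub>Q\<^esub> t) \<in> T" using t not_V by (simp add: U_def V_def)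
        have 1: "\<rho> h (t, y) = (\<pi> h \<otimes>\<^bsub>Q\<^esub> t, \<sigma> (c h t) y)"
          using t y ht by (simp add: \<rho> D_def act_def)
        have 2: "\<rho> g (\<pi> h \<otimes>\<^bsub>Q\<^esub> t, \<sigma> (c h t) y) =
            (\<pi> g \<otimes>\<^bsub>Q\<^esub> (\<pi> h \<otimes>\<^bsub>Q\<^esub> t), \<sigma> (c g (\<pi> h \<otimes>\<^bsub>Q\<^esub> t)) (\<sigma> (c h t) y))"
          using y ht ght \<sigma>_mem[OF c_kernel] by (simp add: \<rho> D_def act_def)
        have 3: "\<rho> (g \<otimes>\<^bsub>G\<^esub> h) (t, y) =
            (\<pi> g \<otimes>\<^bsub>Q\<^esub> (\<pi> h \<otimes>\<^bsub>Q\<^esub> t), \<sigma> (c g (\<pi> h \<otimes>\<^bsub>Q\<^esub> t) \<otimes>\<^bsub>G\<^esub> c h t) y)"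
          using t y ght by (simp add: \<rho> D_def act_def cocycle H.m_assoc)
        show False
          using ne not_Z y ht by (simp add: 1 2 3 Z_def)
      qed
    qed
    then have "card {x \<in> W. \<rho> (g \<otimes>\<^bsub>G\<^esub> h) x \<noteq> \<rho> g (\<rho> h x)} \<le>
        card ((U h \<times> Y \<union> V \<times> Y) \<union> (SIGMA t:T. Z t))"
      using T finU finV finY by (intro card_mono) (auto simp: Z_def)
    also have "\<dots> \<le> card (U h \<times> Y) + card (V \<times> Y) + card (SIGMA t:T. Z t)"
      by (meson add_le_mono1 card_Un_le order_trans)
    finally have "real (card {x \<in> W. \<rho> (g \<otimes>\<^bsub>G\<^esub> h) x \<noteq> \<rho> g (\<rho> h x)}) \<le>
        real (card (U h \<times> Y)) + real (card (V \<times> Y)) + real (card (SIGMA t:T. Z t))"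
      by linarith
    moreover have "real (card (SIGMA t:T. Z t)) \<le> \<epsilon> * real (card W)"
    proof (rule fibres)
      fix t assume t: "t \<in> T"
      show "Z t \<subseteq> Y" by (auto simp: Z_def)
      show "real (card (Z t)) \<le> \<epsilon> * real (card Y)"
        using Y S[OF gh(1), of "\<pi> h \<otimes>\<^bsub>Q\<^esub> t"] S[OF gh(2) t] \<epsilon>
        by (auto simp: Z_def sofic_approx_def)
    qed
    ultimately show "real (card {x \<in> W. \<rho> (g \<otimes>\<^bsub>G\<^esub> h) x \<noteq> \<rho> g (\<rho> h x)}) \<le> \<epsilon>' * real (card W)"
      using U[OF gh(2)] V by (simp add: \<epsilon>_def)
  next
    fix g assume g: "g \<in> F" "g \<noteq> \<one>\<^bsub>G\<^esub>"
    then have [simp]: "g \<in> carrier G" using F by auto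
    \<comment> \<open>A moved base point admits no fixed point in its fibre; over a fixed one the
      cocycle value is nontrivial by \<open>c_one\<close>, so few points are fixed.\<close>
    define Z where "Z t = (if \<pi> g \<otimes>\<^bsub>Q\<^esub> t = t then {y \<in> Y. \<sigma> (c g t) y = y} else {})" for t
    have "{x \<in> W. \<rho> g x = x} \<subseteq> U g \<times> Y \<union> (SIGMA t:T. Z t)"
    proof (clarsimp simp: W_def)
      fix t y
      assume t: "t \<in> T" and y: "y \<in> Y" and eq: "\<rho> g (t, y) = (t, y)" and "y \<notin> Z t"
      show "t \<in> U g"
      proof (rule ccontr)
        assume "t \<notin> U g"
        then have "\<rho> g (t, y) = (\<pi> g \<otimes>\<^bsub>Q\<^esub> t, \<sigma> (c g t) y)"
          using t y by (simp add: \<rho> D_def act_def U_def)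
        then show False using eq y \<open>y \<notin> Z t\<close> by (simp add: Z_def)
      qed
    qed
    then have "card {x \<in> W. \<rho> g x = x} \<le> card (U g \<times> Y \<union> (SIGMA t:T. Z t))"
      using T finU finY by (intro card_mono) (auto simp: Z_def)
    also have "\<dots> \<le> card (U g \<times> Y) + card (SIGMA t:T. Z t)"
      by (rule card_Un_le)
    finally have "real (card {x \<in> W. \<rho> g x = x}) \<le>
        real (card (U g \<times> Y)) + real (card (SIGMA t:T. Z t))"
      by linarith
    moreover have "real (card (SIGMA t:T. Z t)) \<le> \<epsilon> * real (card W)"
    proof (rule fibres)
      fix t assume t: "t \<in> T"
      then have "t \<in> carrier Q" using T by auto
      then show "Z t \<subseteq> Y" "real (card (Z t)) \<le> \<epsilon> * real (card Y)"
        using Y S[OF g(1) t] c_one[OF _ _ _ g(2)] \<epsilon> by (auto simp: Z_def sofic_approx_def)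
    qed
    moreover have "0 \<le> \<epsilon> * real (card W)" using \<epsilon> by simp
    ultimately show "real (card {x \<in> W. \<rho> g x = x}) \<le> \<epsilon>' * real (card W)"
      using U[OF g(1)] by (simp add: \<epsilon>_def)
  qed
  then show "\<exists>(Y :: ('c \<times> nat) set) \<sigma>. sofic_approx G F \<epsilon>' Y \<sigma>" by blast
qed

section \<open>Climbing the derived series\<close>

lemma locally_sofic_of_derived:
  assumes "group G" "locally_sofic (G\<lparr>carrier := derived G (carrier G)\<rparr>)"
  shows "locally_sofic G"
proof -
  interpret group G by fact
  let ?N = "derived G (carrier G)"
  interpret N: normal ?N G by (rule derived_self_is_normal)
  interpret Q: comm_group "G Mod ?N" by (rule derived_quot_is_comm_group)
  interpret \<pi>: group_hom G "G Mod ?N" "\<lambda>g. ?N #>\<^bsub>G\<^esub> g"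
    by unfold_locales (rule N.r_coset_hom_Mod)
  have "?N #>\<^bsub>G\<^esub> g = ?N \<longleftrightarrow> g \<in> ?N" if "g \<in> carrier G" for g
    using that coset_join1[OF _ that N.subgroup_axioms] N.rcos_const[OF is_group] by blast
  then have "kernel G (G Mod ?N) (\<lambda>g. ?N #>\<^bsub>G\<^esub> g) = ?N"
    using N.subset by (auto simp: kernel_def)
  then show ?thesis
    using assms(2) locally_sofic_extension[OF \<pi>.group_hom_axioms Q.comm_group_axioms]
    by (simp add: carrier_FactGroup)
qed

lemma locally_sofic_of_iterated_derived:
  assumes "group G" "locally_sofic (G\<lparr>carrier := (derived G ^^ n) (carrier G)\<rparr>)"
  shows "locally_sofic G"
  using assms(2)
proof (induction n)
  case 0
  then show ?case by simp
next
  case (Suc n)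
  interpret group G by fact
  let ?M = "(derived G ^^ n) (carrier G)"
  have M: "subgroup ?M G" by (rule exp_of_derived_is_subgroup[OF subgroup_self])
  \<comment> \<open>The derived subgroup of the n-th term is the same computed inside that term or
    inside \<open>G\<close>, so the one-step result applies to the term as a group.\<close>
  have "derived (G\<lparr>carrier := ?M\<rparr>) ?M = derived G ?M"
    by (rule derived_consistent[OF subset_refl M])
  then have "locally_sofic (G\<lparr>carrier := ?M\<rparr>)"
    using Suc.prems locally_sofic_of_derived[OF subgroup.subgroup_is_group[OF M is_group]] by simp
  then show ?case by (rule Suc.IH)
qed


theorem corollary5p2:
  fixes G :: "('a, 'm) monoid_scheme" and s :: nat
  assumes "s \<ge> 1"
    and "group G"
    and "countable (carrier G)"
    and "sofic (Pol s G)"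
  shows "sofic G"
proof -
  interpret group G by fact
  obtain n where s: "s = Suc n" using assms(1) by (cases s) auto
  let ?N = "(derived G ^^ n) (carrier G)"
  have N: "subgroup ?N G" by (rule exp_of_derived_is_subgroup[OF subgroup_self])
  have hom: "pol_map s \<in> hom (G\<lparr>carrier := ?N\<rparr>) (Pol s G)"
    unfolding s by (rule pol_map_hom)
  have grp: "group (G\<lparr>carrier := ?N\<rparr>)" by (rule subgroup.subgroup_is_group[OF N is_group])
  interpret p: group_hom "G\<lparr>carrier := ?N\<rparr>" "Pol s G" "pol_map s"
    using grp group_Pol[OF is_group] hom by (simp add: group_hom_def group_hom_axioms_def)
  have "inj_on (pol_map s) (carrier (G\<lparr>carrier := ?N\<rparr>))"
    unfolding p.inj_on_one_iff
    using pol_map_eq_one[OF assms(1)] subgroup.mem_carrier[OF N] by auto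
  then have "locally_sofic (G\<lparr>carrier := ?N\<rparr>)"
    by (rule locally_sofic_embedding[OF grp p.H.is_group hom _ sofic_imp_locally_sofic[OF assms(4)]])
  then show ?thesis
    \<comment> \<open>Countability of \<open>G\<close> is what turns the finitary models back into a
      sequence.\<close>
    using locally_sofic_of_iterated_derived[OF is_group] locally_sofic_imp_sofic assms(2,3) by blast
qed

end
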